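(* Let $C$ be a double category. If $H^*C$ is a decorated 2-groupoid then $\gamma C$ is a double groupoid.
   Context: A double category $C$ (possibly weak in the horizontal direction) consists of a category $C_0$ (objects and vertical morphisms), a category $C_1$ (horizontal morphisms and squares; composition in $C_1$ is vertical composition), functors $s,t:C_1\to C_0$ (left and right edge), a horizontal identity functor $i:C_0\to C_1$ (its value on a vertical morphism $f$ is the square $i_f$), a horizontal composition functor $*:C_1\times_{C_0}C_1\to C_1$, and invertible globular associator and left/right unitor natural transformations satisfying the usual coherence axioms. A square is globular if its left and right edges are identity vertical morphisms. $HC$ denotes the horizontal bicategory of $C$: 0-cells, 1-cells, 2-cells are the objects, horizontal morphisms, globular squares of $C$. A decorated bicategory $\mathcal{B}$ is a bicategory together with a category $\mathcal{B}^*$ (the decoration) whose objects are the 0-cells of $\mathcal{B}$. $H^*C$ is the decorated bicategory given by $HC$ decorated by $C_0$. A decorated bicategory $\mathcal{B}$ is a decorated 2-groupoid if $\mathcal{B}$ is a 2-groupoid (a strict 2-category in which all 1-cells and 2-cells are invertible) and $\mathcal{B}^*$ is a groupoid. $\gamma C$ denotes the globularly generated piece of $C$: the sub-double category with the same objects, vertical and horizontal morphisms, whose squares are those obtained by vertical and horizontal compositions from globular squares and squares $i_f$, $f$ a vertical morphism. A double groupoid is a double category in which vertical morphisms and horizontal morphisms are invertible and every square is both vertically and horizontally invertible. *)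

theory Defs
  imports Main
begin

section \<open>Categories, functors, natural isomorphisms\<close>

record ('o, 'm) cat =
  Obj :: "'o set"
  Arr :: "'m set"
  Dom :: "'m \<Rightarrow> 'o"
  Cod :: "'m \<Rightarrow> 'o"
  Ide :: "'o \<Rightarrow> 'm"
  Cmp :: "'m \<Rightarrow> 'm \<Rightarrow> 'm"  \<comment> \<open>\<open>Cmp A g f\<close> is \<open>g\<close> after \<open>f\<close>\<close>

text \<open>All operations are total HOL functions; only their values on the carriers (and, for
  compositions, on composable arguments) are ever constrained or used.\<close>

definition category :: "('o, 'm) cat \<Rightarrow> bool" where
  "category A \<longleftrightarrow>
     (\<forall>f\<in>Arr A. Dom A f \<in> Obj A \<and> Cod A f \<in> Obj A) \<and>
     (\<forall>x\<in>Obj A. Ide A x \<in> Arr A \<and> Dom A (Ide A x) = x \<and> Cod A (Ide A x) = x) \<and>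
     (\<forall>f\<in>Arr A. \<forall>g\<in>Arr A. Cod A f = Dom A g \<longrightarrow>
        Cmp A g f \<in> Arr A \<and> Dom A (Cmp A g f) = Dom A f \<and> Cod A (Cmp A g f) = Cod A g) \<and>
     (\<forall>f\<in>Arr A. Cmp A f (Ide A (Dom A f)) = f \<and> Cmp A (Ide A (Cod A f)) f = f) \<and>
     (\<forall>f\<in>Arr A. \<forall>g\<in>Arr A. \<forall>h\<in>Arr A. Cod A f = Dom A g \<longrightarrow> Cod A g = Dom A h \<longrightarrow>
        Cmp A h (Cmp A g f) = Cmp A (Cmp A h g) f)"

definition invertible :: "('o, 'm) cat \<Rightarrow> 'm \<Rightarrow> bool" where
  "invertible A f \<longleftrightarrow> f \<in> Arr A \<and>
     (\<exists>g\<in>Arr A. Dom A g = Cod A f \<and> Cod A g = Dom A f \<and>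
        Cmp A g f = Ide A (Dom A f) \<and> Cmp A f g = Ide A (Cod A f))"

definition groupoid :: "('o, 'm) cat \<Rightarrow> bool" where
  "groupoid A \<longleftrightarrow> category A \<and> (\<forall>f\<in>Arr A. invertible A f)"

record ('o1, 'm1, 'o2, 'm2) ftr =
  omap :: "'o1 \<Rightarrow> 'o2"
  amap :: "'m1 \<Rightarrow> 'm2"

definition is_functor ::
    "('o1, 'm1) cat \<Rightarrow> ('o2, 'm2) cat \<Rightarrow> ('o1, 'm1, 'o2, 'm2) ftr \<Rightarrow> bool" where
  "is_functor A B F \<longleftrightarrow> category A \<and> category B \<and>
     (\<forall>x\<in>Obj A. omap F x \<in> Obj B) \<and>
     (\<forall>f\<in>Arr A. amap F f \<in> Arr B \<and>
        Dom B (amap F f) = omap F (Dom A f) \<and> Cod B (amap F f) = omap F (Cod A f)) \<and>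
     (\<forall>x\<in>Obj A. amap F (Ide A x) = Ide B (omap F x)) \<and>
     (\<forall>f\<in>Arr A. \<forall>g\<in>Arr A. Cod A f = Dom A g \<longrightarrow>
        amap F (Cmp A g f) = Cmp B (amap F g) (amap F f))"

definition id_ftr :: "('o, 'm, 'o, 'm) ftr" where
  "id_ftr = \<lparr>omap = (\<lambda>x. x), amap = (\<lambda>f. f)\<rparr>"

definition nat_iso ::
    "('o1, 'm1) cat \<Rightarrow> ('o2, 'm2) cat \<Rightarrow> ('o1, 'm1, 'o2, 'm2) ftr \<Rightarrow> ('o1, 'm1, 'o2, 'm2) ftr
     \<Rightarrow> ('o1 \<Rightarrow> 'm2) \<Rightarrow> bool" where
  "nat_iso A B F G \<eta> \<longleftrightarrow> is_functor A B F \<and> is_functor A B G \<and>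
     (\<forall>x\<in>Obj A. invertible B (\<eta> x) \<and> Dom B (\<eta> x) = omap F x \<and> Cod B (\<eta> x) = omap G x) \<and>
     (\<forall>f\<in>Arr A. Cmp B (\<eta> (Cod A f)) (amap F f) = Cmp B (amap G f) (\<eta> (Dom A f)))"

definition prod_cat :: "('o1, 'm1) cat \<Rightarrow> ('o2, 'm2) cat \<Rightarrow> ('o1 \<times> 'o2, 'm1 \<times> 'm2) cat" where
  "prod_cat A B =
     \<lparr>Obj = Obj A \<times> Obj B,
      Arr = Arr A \<times> Arr B,
      Dom = (\<lambda>(f, g). (Dom A f, Dom B g)),
      Cod = (\<lambda>(f, g). (Cod A f, Cod B g)),
      Ide = (\<lambda>(x, y). (Ide A x, Ide B y)),
      Cmp = (\<lambda>(f', g') (f, g). (Cmp A f' f, Cmp B g' g))\<rparr>"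

definition pullback_cat ::
    "('o1, 'm1) cat \<Rightarrow> ('o2, 'm2) cat \<Rightarrow> ('o1, 'm1, 'o, 'm) ftr \<Rightarrow> ('o2, 'm2, 'o, 'm) ftr
     \<Rightarrow> ('o1 \<times> 'o2, 'm1 \<times> 'm2) cat" where
  "pullback_cat A B F G =
     (prod_cat A B)\<lparr>Obj := {(x, y). x \<in> Obj A \<and> y \<in> Obj B \<and> omap F x = omap G y},
                    Arr := {(f, g). f \<in> Arr A \<and> g \<in> Arr B \<and> amap F f = amap G g}\<rparr>"


section \<open>Double categories\<close>

text \<open>Horizontal composition is written in diagrammatic order: \<open>hc C f g\<close> is \<open>f\<close> followed by \<open>g\<close>
  and is meaningful when the right edge of \<open>f\<close> is the left edge of \<open>g\<close>.\<close>

record ('o, 'v, 'h, 's) dblcat =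
  C0 :: "('o, 'v) cat"
  C1 :: "('h, 's) cat"
  sF :: "('h, 's, 'o, 'v) ftr"
  tF :: "('h, 's, 'o, 'v) ftr"
  iF :: "('o, 'v, 'h, 's) ftr"
  cF :: "('h \<times> 'h, 's \<times> 's, 'h, 's) ftr"
  asso :: "'h \<Rightarrow> 'h \<Rightarrow> 'h \<Rightarrow> 's"
  luni :: "'h \<Rightarrow> 's"
  runi :: "'h \<Rightarrow> 's"

abbreviation hc :: "('o, 'v, 'h, 's) dblcat \<Rightarrow> 'h \<Rightarrow> 'h \<Rightarrow> 'h" where
  "hc C f g \<equiv> omap (cF C) (f, g)"

abbreviation hs :: "('o, 'v, 'h, 's) dblcat \<Rightarrow> 's \<Rightarrow> 's \<Rightarrow> 's" where
  "hs C \<phi> \<psi> \<equiv> amap (cF C) (\<phi>, \<psi>)"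

definition C1_2 :: "('o, 'v, 'h, 's) dblcat \<Rightarrow> ('h \<times> 'h, 's \<times> 's) cat" where
  "C1_2 C = pullback_cat (C1 C) (C1 C) (tF C) (sF C)"

definition C1_3 :: "('o, 'v, 'h, 's) dblcat \<Rightarrow> ('h \<times> 'h \<times> 'h, 's \<times> 's \<times> 's) cat" where
  "C1_3 C = pullback_cat (C1 C) (C1_2 C) (tF C)
     \<lparr>omap = (\<lambda>(f, g). omap (sF C) f), amap = (\<lambda>(\<phi>, \<psi>). amap (sF C) \<phi>)\<rparr>"

definition globular :: "('o, 'v, 'h, 's) dblcat \<Rightarrow> 's \<Rightarrow> bool" where
  "globular C \<phi> \<longleftrightarrow> \<phi> \<in> Arr (C1 C) \<and>
     (\<exists>a\<in>Obj (C0 C). amap (sF C) \<phi> = Ide (C0 C) a) \<and>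
     (\<exists>b\<in>Obj (C0 C). amap (tF C) \<phi> = Ide (C0 C) b)"

definition double_category :: "('o, 'v, 'h, 's) dblcat \<Rightarrow> bool" where
  "double_category C \<longleftrightarrow>
     category (C0 C) \<and> category (C1 C) \<and>
     is_functor (C1 C) (C0 C) (sF C) \<and> is_functor (C1 C) (C0 C) (tF C) \<and>
     is_functor (C0 C) (C1 C) (iF C) \<and> is_functor (C1_2 C) (C1 C) (cF C) \<and>
     (\<forall>a\<in>Obj (C0 C). omap (sF C) (omap (iF C) a) = a \<and> omap (tF C) (omap (iF C) a) = a) \<and>
     (\<forall>u\<in>Arr (C0 C). amap (sF C) (amap (iF C) u) = u \<and> amap (tF C) (amap (iF C) u) = u) \<and>
     (\<forall>(f, g)\<in>Obj (C1_2 C). omap (sF C) (hc C f g) = omap (sF C) f \<and>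
                             omap (tF C) (hc C f g) = omap (tF C) g) \<and>
     (\<forall>(\<phi>, \<psi>)\<in>Arr (C1_2 C). amap (sF C) (hs C \<phi> \<psi>) = amap (sF C) \<phi> \<and>
                             amap (tF C) (hs C \<phi> \<psi>) = amap (tF C) \<psi>) \<and>
     nat_iso (C1_3 C) (C1 C)
       \<lparr>omap = (\<lambda>(f, g, h). hc C (hc C f g) h), amap = (\<lambda>(\<phi>, \<psi>, \<chi>). hs C (hs C \<phi> \<psi>) \<chi>)\<rparr>
       \<lparr>omap = (\<lambda>(f, g, h). hc C f (hc C g h)), amap = (\<lambda>(\<phi>, \<psi>, \<chi>). hs C \<phi> (hs C \<psi> \<chi>))\<rparr>
       (\<lambda>(f, g, h). asso C f g h) \<and>
     nat_iso (C1 C) (C1 C)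
       \<lparr>omap = (\<lambda>f. hc C (omap (iF C) (omap (sF C) f)) f),
        amap = (\<lambda>\<phi>. hs C (amap (iF C) (amap (sF C) \<phi>)) \<phi>)\<rparr>
       id_ftr (luni C) \<and>
     nat_iso (C1 C) (C1 C)
       \<lparr>omap = (\<lambda>f. hc C f (omap (iF C) (omap (tF C) f))),
        amap = (\<lambda>\<phi>. hs C \<phi> (amap (iF C) (amap (tF C) \<phi>)))\<rparr>
       id_ftr (runi C) \<and>
     (\<forall>(f, g, h)\<in>Obj (C1_3 C). globular C (asso C f g h)) \<and>
     (\<forall>f\<in>Obj (C1 C). globular C (luni C f) \<and> globular C (runi C f)) \<and>
     \<comment> \<open>pentagon\<close>
     (\<forall>f g h k. (f, g, h) \<in> Obj (C1_3 C) \<longrightarrow> (g, h, k) \<in> Obj (C1_3 C) \<longrightarrow>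
        Cmp (C1 C) (asso C f g (hc C h k)) (asso C (hc C f g) h k) =
        Cmp (C1 C) (hs C (Ide (C1 C) f) (asso C g h k))
          (Cmp (C1 C) (asso C f (hc C g h) k) (hs C (asso C f g h) (Ide (C1 C) k)))) \<and>
     \<comment> \<open>triangle\<close>
     (\<forall>(f, g)\<in>Obj (C1_2 C).
        Cmp (C1 C) (hs C (Ide (C1 C) f) (luni C g))
          (asso C f (omap (iF C) (omap (tF C) f)) g) =
        hs C (runi C f) (Ide (C1 C) g))"

text \<open>Horizontal invertibility is on the nose. The inverse of a square from \<open>u\<close> (left edge) to
  \<open>v\<close> (right edge) goes from \<open>v\<close> to \<open>u\<close>, and the composites are the squares \<open>i\<^sub>u\<close> and \<open>i\<^sub>v\<close>.\<close>

definition hinvertible_mor :: "('o, 'v, 'h, 's) dblcat \<Rightarrow> 'h \<Rightarrow> bool" where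
  "hinvertible_mor C f \<longleftrightarrow> f \<in> Obj (C1 C) \<and>
     (\<exists>g\<in>Obj (C1 C). omap (sF C) g = omap (tF C) f \<and> omap (tF C) g = omap (sF C) f \<and>
        hc C f g = omap (iF C) (omap (sF C) f) \<and> hc C g f = omap (iF C) (omap (tF C) f))"

definition hinvertible_sq :: "('o, 'v, 'h, 's) dblcat \<Rightarrow> 's \<Rightarrow> bool" where
  "hinvertible_sq C \<phi> \<longleftrightarrow> \<phi> \<in> Arr (C1 C) \<and>
     (\<exists>\<psi>\<in>Arr (C1 C). amap (sF C) \<psi> = amap (tF C) \<phi> \<and> amap (tF C) \<psi> = amap (sF C) \<phi> \<and>
        hs C \<phi> \<psi> = amap (iF C) (amap (sF C) \<phi>) \<and> hs C \<psi> \<phi> = amap (iF C) (amap (tF C) \<phi>))"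

definition double_groupoid :: "('o, 'v, 'h, 's) dblcat \<Rightarrow> bool" where
  "double_groupoid C \<longleftrightarrow> double_category C \<and>
     (\<forall>u\<in>Arr (C0 C). invertible (C0 C) u) \<and>
     (\<forall>f\<in>Obj (C1 C). hinvertible_mor C f) \<and>
     (\<forall>\<phi>\<in>Arr (C1 C). invertible (C1 C) \<phi> \<and> hinvertible_sq C \<phi>)"


section \<open>The globularly generated piece\<close>

inductive_set gg_squares :: "('o, 'v, 'h, 's) dblcat \<Rightarrow> 's set"
  for C :: "('o, 'v, 'h, 's) dblcat" where
  glob: "globular C \<phi> \<Longrightarrow> \<phi> \<in> gg_squares C"
| hid: "u \<in> Arr (C0 C) \<Longrightarrow> amap (iF C) u \<in> gg_squares C"
| vcomp: "\<phi> \<in> gg_squares C \<Longrightarrow> \<psi> \<in> gg_squares C \<Longrightarrow> Cod (C1 C) \<phi> = Dom (C1 C) \<psi> \<Longrightarrow>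
    Cmp (C1 C) \<psi> \<phi> \<in> gg_squares C"
| hcomp: "\<phi> \<in> gg_squares C \<Longrightarrow> \<psi> \<in> gg_squares C \<Longrightarrow> amap (tF C) \<phi> = amap (sF C) \<psi> \<Longrightarrow>
    hs C \<phi> \<psi> \<in> gg_squares C"

definition gamma :: "('o, 'v, 'h, 's) dblcat \<Rightarrow> ('o, 'v, 'h, 's) dblcat" where
  "gamma C = C\<lparr>C1 := (C1 C)\<lparr>Arr := gg_squares C\<rparr>\<rparr>"


section \<open>Bicategories and decorated bicategories\<close>

text \<open>Horizontal composition \<open>HCmp B a b c\<close> is again in diagrammatic order,
  from \<open>Hom B a b \<times> Hom B b c\<close> to \<open>Hom B a c\<close>.\<close>

record ('o, 'h, 's) bicat =
  Cell0 :: "'o set"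
  Hom :: "'o \<Rightarrow> 'o \<Rightarrow> ('h, 's) cat"
  Unit :: "'o \<Rightarrow> 'h"
  HCmp :: "'o \<Rightarrow> 'o \<Rightarrow> 'o \<Rightarrow> ('h \<times> 'h, 's \<times> 's, 'h, 's) ftr"
  Asso :: "'o \<Rightarrow> 'o \<Rightarrow> 'o \<Rightarrow> 'o \<Rightarrow> 'h \<Rightarrow> 'h \<Rightarrow> 'h \<Rightarrow> 's"
  Luni :: "'o \<Rightarrow> 'o \<Rightarrow> 'h \<Rightarrow> 's"
  Runi :: "'o \<Rightarrow> 'o \<Rightarrow> 'h \<Rightarrow> 's"

abbreviation bc1 ::
    "('o, 'h, 's) bicat \<Rightarrow> 'o \<Rightarrow> 'o \<Rightarrow> 'o \<Rightarrow> 'h \<Rightarrow> 'h \<Rightarrow> 'h" where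
  "bc1 B a b c f g \<equiv> omap (HCmp B a b c) (f, g)"

abbreviation bc2 ::
    "('o, 'h, 's) bicat \<Rightarrow> 'o \<Rightarrow> 'o \<Rightarrow> 'o \<Rightarrow> 's \<Rightarrow> 's \<Rightarrow> 's" where
  "bc2 B a b c \<phi> \<psi> \<equiv> amap (HCmp B a b c) (\<phi>, \<psi>)"

definition bicategory :: "('o, 'h, 's) bicat \<Rightarrow> bool" where
  "bicategory B \<longleftrightarrow>
     (\<forall>a\<in>Cell0 B. \<forall>b\<in>Cell0 B. category (Hom B a b)) \<and>
     (\<forall>a\<in>Cell0 B. Unit B a \<in> Obj (Hom B a a)) \<and>
     (\<forall>a\<in>Cell0 B. \<forall>b\<in>Cell0 B. \<forall>c\<in>Cell0 B.
        is_functor (prod_cat (Hom B a b) (Hom B b c)) (Hom B a c) (HCmp B a b c)) \<and>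
     (\<forall>a\<in>Cell0 B. \<forall>b\<in>Cell0 B. \<forall>c\<in>Cell0 B. \<forall>d\<in>Cell0 B.
        nat_iso (prod_cat (Hom B a b) (prod_cat (Hom B b c) (Hom B c d))) (Hom B a d)
          \<lparr>omap = (\<lambda>(f, g, h). bc1 B a c d (bc1 B a b c f g) h),
           amap = (\<lambda>(\<phi>, \<psi>, \<chi>). bc2 B a c d (bc2 B a b c \<phi> \<psi>) \<chi>)\<rparr>
          \<lparr>omap = (\<lambda>(f, g, h). bc1 B a b d f (bc1 B b c d g h)),
           amap = (\<lambda>(\<phi>, \<psi>, \<chi>). bc2 B a b d \<phi> (bc2 B b c d \<psi> \<chi>))\<rparr>
          (\<lambda>(f, g, h). Asso B a b c d f g h)) \<and>
     (\<forall>a\<in>Cell0 B. \<forall>b\<in>Cell0 B.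
        nat_iso (Hom B a b) (Hom B a b)
          \<lparr>omap = (\<lambda>f. bc1 B a a b (Unit B a) f),
           amap = (\<lambda>\<phi>. bc2 B a a b (Ide (Hom B a a) (Unit B a)) \<phi>)\<rparr>
          id_ftr (Luni B a b) \<and>
        nat_iso (Hom B a b) (Hom B a b)
          \<lparr>omap = (\<lambda>f. bc1 B a b b f (Unit B b)),
           amap = (\<lambda>\<phi>. bc2 B a b b \<phi> (Ide (Hom B b b) (Unit B b)))\<rparr>
          id_ftr (Runi B a b)) \<and>
     \<comment> \<open>pentagon\<close>
     (\<forall>a\<in>Cell0 B. \<forall>b\<in>Cell0 B. \<forall>c\<in>Cell0 B. \<forall>d\<in>Cell0 B. \<forall>e\<in>Cell0 B.
        \<forall>f\<in>Obj (Hom B a b). \<forall>g\<in>Obj (Hom B b c). \<forall>h\<in>Obj (Hom B c d). \<forall>k\<in>Obj (Hom B d e).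
        Cmp (Hom B a e) (Asso B a b c e f g (bc1 B c d e h k)) (Asso B a c d e (bc1 B a b c f g) h k) =
        Cmp (Hom B a e) (bc2 B a b e (Ide (Hom B a b) f) (Asso B b c d e g h k))
          (Cmp (Hom B a e) (Asso B a b d e f (bc1 B b c d g h) k)
             (bc2 B a d e (Asso B a b c d f g h) (Ide (Hom B d e) k)))) \<and>
     \<comment> \<open>triangle\<close>
     (\<forall>a\<in>Cell0 B. \<forall>b\<in>Cell0 B. \<forall>c\<in>Cell0 B. \<forall>f\<in>Obj (Hom B a b). \<forall>g\<in>Obj (Hom B b c).
        Cmp (Hom B a c) (bc2 B a b c (Ide (Hom B a b) f) (Luni B b c g)) (Asso B a b b c f (Unit B b) g) =
        bc2 B a b c (Runi B a b f) (Ide (Hom B b c) g))"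

text \<open>Since the associator goes from \<open>(f g) h\<close> to \<open>f (g h)\<close>, requiring its components (and
  those of the unitors) to be identities includes the equality of the two bracketings.\<close>

definition strict_2_category :: "('o, 'h, 's) bicat \<Rightarrow> bool" where
  "strict_2_category B \<longleftrightarrow> bicategory B \<and>
     (\<forall>a\<in>Cell0 B. \<forall>b\<in>Cell0 B. \<forall>c\<in>Cell0 B. \<forall>d\<in>Cell0 B.
        \<forall>f\<in>Obj (Hom B a b). \<forall>g\<in>Obj (Hom B b c). \<forall>h\<in>Obj (Hom B c d).
          Asso B a b c d f g h = Ide (Hom B a d) (bc1 B a c d (bc1 B a b c f g) h)) \<and>
     (\<forall>a\<in>Cell0 B. \<forall>b\<in>Cell0 B. \<forall>f\<in>Obj (Hom B a b).
          Luni B a b f = Ide (Hom B a b) f \<and> Runi B a b f = Ide (Hom B a b) f)"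

definition two_groupoid :: "('o, 'h, 's) bicat \<Rightarrow> bool" where
  "two_groupoid B \<longleftrightarrow> strict_2_category B \<and>
     (\<forall>a\<in>Cell0 B. \<forall>b\<in>Cell0 B. \<forall>f\<in>Obj (Hom B a b).
        \<exists>g\<in>Obj (Hom B b a). bc1 B a b a f g = Unit B a \<and> bc1 B b a b g f = Unit B b) \<and>
     (\<forall>a\<in>Cell0 B. \<forall>b\<in>Cell0 B. \<forall>\<phi>\<in>Arr (Hom B a b). invertible (Hom B a b) \<phi>)"

record ('o, 'v, 'h, 's) decbicat =
  Bic :: "('o, 'h, 's) bicat"
  Deco :: "('o, 'v) cat"

definition decorated_bicategory :: "('o, 'v, 'h, 's) decbicat \<Rightarrow> bool" where
  "decorated_bicategory D \<longleftrightarrow>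
     bicategory (Bic D) \<and> category (Deco D) \<and> Obj (Deco D) = Cell0 (Bic D)"

definition decorated_2_groupoid :: "('o, 'v, 'h, 's) decbicat \<Rightarrow> bool" where
  "decorated_2_groupoid D \<longleftrightarrow>
     decorated_bicategory D \<and> two_groupoid (Bic D) \<and> groupoid (Deco D)"


section \<open>The horizontal bicategory of a double category\<close>

definition hhom :: "('o, 'v, 'h, 's) dblcat \<Rightarrow> 'o \<Rightarrow> 'o \<Rightarrow> ('h, 's) cat" where
  "hhom C a b =
     (C1 C)\<lparr>Obj := {f \<in> Obj (C1 C). omap (sF C) f = a \<and> omap (tF C) f = b},
            Arr := {\<phi> \<in> Arr (C1 C). amap (sF C) \<phi> = Ide (C0 C) a \<and> amap (tF C) \<phi> = Ide (C0 C) b}\<rparr>"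

definition hbicat :: "('o, 'v, 'h, 's) dblcat \<Rightarrow> ('o, 'h, 's) bicat" where
  "hbicat C =
     \<lparr>Cell0 = Obj (C0 C),
      Hom = hhom C,
      Unit = omap (iF C),
      HCmp = (\<lambda>a b c. cF C),
      Asso = (\<lambda>a b c d. asso C),
      Luni = (\<lambda>a b. luni C),
      Runi = (\<lambda>a b. runi C)\<rparr>"

definition Hstar :: "('o, 'v, 'h, 's) dblcat \<Rightarrow> ('o, 'v, 'h, 's) decbicat" where
  "Hstar C = \<lparr>Bic = hbicat C, Deco = C0 C\<rparr>"

end

theory Submission
  imports Defs
begin

text \<open>The hypothesis on \<open>H\<^sup>*C\<close> makes the associator and the unitors of \<open>C\<close> identities, so
  horizontal composition is strictly associative and unital, also on non-globular squares, by
  naturality. Squares with a vertical inverse, and squares with a horizontal inverse, are then each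
  closed under both compositions: interchange does the work, and the inverses to be composed are
  composable because inverses are unique. So only the generators matter. The square \<open>i\<^sub>u\<close> is its own
  horizontal inverse. A globular square \<open>\<phi>\<close> from \<open>f\<close> to \<open>g\<close> with vertical inverse \<open>\<phi>'\<close>
  has horizontal inverse \<open>f\<^sup>- * \<phi>' * g\<^sup>-\<close>.\<close>

section \<open>Wide subcategories\<close>

text \<open>\<open>gamma C\<close> keeps all objects and horizontal morphisms and only shrinks sets
  of squares. Stating the restriction as an update of \<open>Arr\<close> leaves domains, codomains,
  identities and composition untouched, so equations in the larger category are inherited
  verbatim.\<close>

definition wide_subcat :: "('o, 'm) cat \<Rightarrow> 'm set \<Rightarrow> bool" where
  "wide_subcat A S \<longleftrightarrow> S \<subseteq> Arr A \<and> (\<forall>x\<in>Obj A. Ide A x \<in> S) \<and>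
     (\<forall>f\<in>S. \<forall>g\<in>S. Cod A f = Dom A g \<longrightarrow> Cmp A g f \<in> S)"

lemma category_wide_subcat:
  assumes "category A" "wide_subcat A S"
  shows "category (A\<lparr>Arr := S\<rparr>)"
  using assms unfolding category_def wide_subcat_def
  by (simp add: subset_iff)

lemma is_functor_wide_subcat:
  assumes "is_functor A B F" "wide_subcat A S" "wide_subcat B T"
    and "\<And>f. f \<in> S \<Longrightarrow> amap F f \<in> T"
  shows "is_functor (A\<lparr>Arr := S\<rparr>) (B\<lparr>Arr := T\<rparr>) F"
proof -
  have "category (A\<lparr>Arr := S\<rparr>)" "category (B\<lparr>Arr := T\<rparr>)"
    using assms category_wide_subcat unfolding is_functor_def by blast+
  with assms show ?thesis
    unfolding is_functor_def wide_subcat_def by (simp add: subset_iff)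
qed

text \<open>Naturality equations restrict to fewer arrows, but an inverse taken in \<open>B\<close>
  may fall outside \<open>T\<close>. Invertibility of the components in the smaller category is
  therefore a separate hypothesis.\<close>

lemma nat_iso_wide_subcat:
  assumes "nat_iso A B F G \<eta>" "wide_subcat A S" "wide_subcat B T"
    and "\<And>f. f \<in> S \<Longrightarrow> amap F f \<in> T" "\<And>f. f \<in> S \<Longrightarrow> amap G f \<in> T"
    and "\<And>x. x \<in> Obj A \<Longrightarrow> invertible (B\<lparr>Arr := T\<rparr>) (\<eta> x)"
  shows "nat_iso (A\<lparr>Arr := S\<rparr>) (B\<lparr>Arr := T\<rparr>) F G \<eta>"
  using assms is_functor_wide_subcat[of A B F S T] is_functor_wide_subcat[of A B G S T]
  unfolding nat_iso_def wide_subcat_def by (simp add: subset_iff)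

lemma wide_subcat_Arr: "category A \<Longrightarrow> wide_subcat A (Arr A)"
  unfolding category_def wide_subcat_def by simp

lemma cat_update_Arr_Arr: "A\<lparr>Arr := Arr A\<rparr> = A"
  by (cases A) simp

text \<open>A left inverse \<open>g\<close> and a right inverse \<open>h\<close> agree because both
  equal \<open>Cmp A g (Cmp A f h)\<close>. In \<open>C0 C\<close> this identifies the edges of
  vertical inverses that are to be composed horizontally.\<close>

lemma inverse_unique:
  assumes A: "category A" and arr: "f \<in> Arr A" "g \<in> Arr A" "h \<in> Arr A"
    and "Dom A g = Cod A f" "Dom A h = Cod A f" "Cod A h = Dom A f"
    and gf: "Cmp A g f = Ide A (Dom A f)" and fh: "Cmp A f h = Ide A (Cod A f)"
  shows "g = h"
proof -
  have assoc: "\<forall>f\<in>Arr A. \<forall>g\<in>Arr A. \<forall>h\<in>Arr A. Cod A f = Dom A g \<longrightarrow> Cod A g = Dom A h \<longrightarrow>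
      Cmp A h (Cmp A g f) = Cmp A (Cmp A h g) f"
    and unit: "\<forall>f\<in>Arr A. Cmp A f (Ide A (Dom A f)) = f \<and> Cmp A (Ide A (Cod A f)) f = f"
    using A by (simp_all add: category_def)
  have "g = Cmp A g (Cmp A f h)" "Cmp A (Cmp A g f) h = h"
    using unit arr assms(5-7) gf fh by metis+
  moreover have "Cmp A g (Cmp A f h) = Cmp A (Cmp A g f) h"
    using assoc arr assms(5,7) by simp
  ultimately show ?thesis by simp
qed


section \<open>Strict double categories\<close>

lemma Obj_C1_2: "Obj (C1_2 C) =
    {(f, g). f \<in> Obj (C1 C) \<and> g \<in> Obj (C1 C) \<and> omap (tF C) f = omap (sF C) g}"
  and Arr_C1_2: "Arr (C1_2 C) =
    {(f, g). f \<in> Arr (C1 C) \<and> g \<in> Arr (C1 C) \<and> amap (tF C) f = amap (sF C) g}"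
  and C1_2_sel: "Dom (C1_2 C) = (\<lambda>(f, g). (Dom (C1 C) f, Dom (C1 C) g))"
    "Cod (C1_2 C) = (\<lambda>(f, g). (Cod (C1 C) f, Cod (C1 C) g))"
    "Ide (C1_2 C) = (\<lambda>(f, g). (Ide (C1 C) f, Ide (C1 C) g))"
    "Cmp (C1_2 C) = (\<lambda>(f', g') (f, g). (Cmp (C1 C) f' f, Cmp (C1 C) g' g))"
  unfolding C1_2_def pullback_cat_def prod_cat_def by simp_all

lemma Obj_C1_3: "Obj (C1_3 C) = {(f, g, h). f \<in> Obj (C1 C) \<and> (g, h) \<in> Obj (C1_2 C) \<and>
      omap (tF C) f = omap (sF C) g}"
  and Arr_C1_3: "Arr (C1_3 C) = {(f, g, h). f \<in> Arr (C1 C) \<and> (g, h) \<in> Arr (C1_2 C) \<and>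
      amap (tF C) f = amap (sF C) g}"
  and C1_3_sel: "Dom (C1_3 C) = (\<lambda>(f, g, h). (Dom (C1 C) f, Dom (C1 C) g, Dom (C1 C) h))"
    "Cod (C1_3 C) = (\<lambda>(f, g, h). (Cod (C1 C) f, Cod (C1 C) g, Cod (C1 C) h))"
    "Ide (C1_3 C) = (\<lambda>(f, g, h). (Ide (C1 C) f, Ide (C1 C) g, Ide (C1 C) h))"
    "Cmp (C1_3 C) = (\<lambda>(f', g', h') (f, g, h).
       (Cmp (C1 C) f' f, Cmp (C1 C) g' g, Cmp (C1 C) h' h))"
  unfolding C1_3_def pullback_cat_def prod_cat_def
  by (auto simp: C1_2_sel fun_eq_iff)

section \<open>Edges, boundaries and interchange in a double category\<close>

locale dbl_category =
  fixes C :: "('o, 'v, 'h, 's) dblcat"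
  assumes double_category: "double_category C"
begin

abbreviation hmor where "hmor \<equiv> Obj (C1 C)"
abbreviation sq where "sq \<equiv> Arr (C1 C)"
abbreviation so where "so \<equiv> omap (sF C)"
abbreviation to where "to \<equiv> omap (tF C)"
abbreviation io where "io \<equiv> omap (iF C)"
abbreviation sa where "sa \<equiv> amap (sF C)"
abbreviation ta where "ta \<equiv> amap (tF C)"
abbreviation ia where "ia \<equiv> amap (iF C)"
abbreviation dom where "dom \<equiv> Dom (C1 C)"
abbreviation cod where "cod \<equiv> Cod (C1 C)"
abbreviation ide where "ide \<equiv> Ide (C1 C)"
abbreviation vcmp (infixr "\<cdot>" 60) where "\<psi> \<cdot> \<phi> \<equiv> Cmp (C1 C) \<psi> \<phi>"
abbreviation hcmp (infixr "\<star>" 65) where "\<phi> \<star> \<psi> \<equiv> hs C \<phi> \<psi>"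
abbreviation hcmp_mor (infixr "\<odot>" 65) where "f \<odot> g \<equiv> hc C f g"

lemma cat0: "category (C0 C)" and cat1: "category (C1 C)"
  and functor_s: "is_functor (C1 C) (C0 C) (sF C)"
  and functor_t: "is_functor (C1 C) (C0 C) (tF C)"
  and functor_i: "is_functor (C0 C) (C1 C) (iF C)"
  and functor_c: "is_functor (C1_2 C) (C1 C) (cF C)"
  using double_category by (simp_all add: double_category_def)

lemma s_io [simp]: "a \<in> Obj (C0 C) \<Longrightarrow> so (io a) = a"
  and t_io [simp]: "a \<in> Obj (C0 C) \<Longrightarrow> to (io a) = a"
  and s_ia [simp]: "u \<in> Arr (C0 C) \<Longrightarrow> sa (ia u) = u"
  and t_ia [simp]: "u \<in> Arr (C0 C) \<Longrightarrow> ta (ia u) = u"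
  using double_category by (simp_all add: double_category_def)

lemma dom_cod_hmor [simp]: "\<phi> \<in> sq \<Longrightarrow> dom \<phi> \<in> hmor" "\<phi> \<in> sq \<Longrightarrow> cod \<phi> \<in> hmor"
  and ide_sq [simp]: "f \<in> hmor \<Longrightarrow> ide f \<in> sq"
  and dom_ide [simp]: "f \<in> hmor \<Longrightarrow> dom (ide f) = f"
  and cod_ide [simp]: "f \<in> hmor \<Longrightarrow> cod (ide f) = f"
  and vcmp_unit [simp]: "\<phi> \<in> sq \<Longrightarrow> \<phi> \<cdot> ide (dom \<phi>) = \<phi>" "\<phi> \<in> sq \<Longrightarrow> ide (cod \<phi>) \<cdot> \<phi> = \<phi>"
  using cat1 by (simp_all add: category_def)

lemma vcmp_sq [simp]:
  assumes "\<phi> \<in> sq" "\<psi> \<in> sq" "cod \<phi> = dom \<psi>"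
  shows "\<psi> \<cdot> \<phi> \<in> sq" "dom (\<psi> \<cdot> \<phi>) = dom \<phi>" "cod (\<psi> \<cdot> \<phi>) = cod \<psi>"
  using cat1 assms by (simp_all add: category_def)

lemma vcmp_assoc:
  assumes "\<phi> \<in> sq" "\<psi> \<in> sq" "\<chi> \<in> sq" "cod \<phi> = dom \<psi>" "cod \<psi> = dom \<chi>"
  shows "(\<chi> \<cdot> \<psi>) \<cdot> \<phi> = \<chi> \<cdot> \<psi> \<cdot> \<phi>"
  using cat1 assms unfolding category_def by metis

lemma st_mor [simp]:
  "f \<in> hmor \<Longrightarrow> so f \<in> Obj (C0 C)" "f \<in> hmor \<Longrightarrow> to f \<in> Obj (C0 C)"
  "f \<in> hmor \<Longrightarrow> sa (ide f) = Ide (C0 C) (so f)" "f \<in> hmor \<Longrightarrow> ta (ide f) = Ide (C0 C) (to f)"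
  "\<phi> \<in> sq \<Longrightarrow> sa \<phi> \<in> Arr (C0 C)" "\<phi> \<in> sq \<Longrightarrow> ta \<phi> \<in> Arr (C0 C)"
  "\<phi> \<in> sq \<Longrightarrow> Dom (C0 C) (sa \<phi>) = so (dom \<phi>)" "\<phi> \<in> sq \<Longrightarrow> Cod (C0 C) (sa \<phi>) = so (cod \<phi>)"
  "\<phi> \<in> sq \<Longrightarrow> Dom (C0 C) (ta \<phi>) = to (dom \<phi>)" "\<phi> \<in> sq \<Longrightarrow> Cod (C0 C) (ta \<phi>) = to (cod \<phi>)"
  using functor_s functor_t by (simp_all add: is_functor_def)

lemma st_vcmp [simp]:
  assumes "\<phi> \<in> sq" "\<psi> \<in> sq" "cod \<phi> = dom \<psi>"
  shows "sa (\<psi> \<cdot> \<phi>) = Cmp (C0 C) (sa \<psi>) (sa \<phi>)" "ta (\<psi> \<cdot> \<phi>) = Cmp (C0 C) (ta \<psi>) (ta \<phi>)"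
  using functor_s functor_t assms by (simp_all add: is_functor_def)

lemma i_simps [simp]:
  "a \<in> Obj (C0 C) \<Longrightarrow> io a \<in> hmor"
  "a \<in> Obj (C0 C) \<Longrightarrow> ia (Ide (C0 C) a) = ide (io a)"
  "u \<in> Arr (C0 C) \<Longrightarrow> ia u \<in> sq"
  "u \<in> Arr (C0 C) \<Longrightarrow> dom (ia u) = io (Dom (C0 C) u)"
  "u \<in> Arr (C0 C) \<Longrightarrow> cod (ia u) = io (Cod (C0 C) u)"
  using functor_i by (simp_all add: is_functor_def)

lemma ia_Cmp:
  assumes "u \<in> Arr (C0 C)" "v \<in> Arr (C0 C)" "Cod (C0 C) u = Dom (C0 C) v"
  shows "ia (Cmp (C0 C) v u) = ia v \<cdot> ia u"
  using functor_i assms by (simp add: is_functor_def)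

lemma hcmp_mor [simp]:
  assumes "f \<in> hmor" "g \<in> hmor" "to f = so g"
  shows "f \<odot> g \<in> hmor" "so (f \<odot> g) = so f" "to (f \<odot> g) = to g"
    and "ide f \<star> ide g = ide (f \<odot> g)"
proof -
  have fg: "(f, g) \<in> Obj (C1_2 C)"
    using assms by (simp add: Obj_C1_2)
  then show "f \<odot> g \<in> hmor" using functor_c by (simp add: is_functor_def)
  show "so (f \<odot> g) = so f" "to (f \<odot> g) = to g"
    using double_category fg by (auto simp: double_category_def)
  have "amap (cF C) (Ide (C1_2 C) (f, g)) = ide (f \<odot> g)"
    using functor_c fg by (simp add: is_functor_def)
  then show "ide f \<star> ide g = ide (f \<odot> g)" by (simp add: C1_2_sel)
qed

lemma hcmp_sq [simp]:
  assumes "\<phi> \<in> sq" "\<psi> \<in> sq" "ta \<phi> = sa \<psi>"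
  shows "\<phi> \<star> \<psi> \<in> sq" "sa (\<phi> \<star> \<psi>) = sa \<phi>" "ta (\<phi> \<star> \<psi>) = ta \<psi>"
    and "dom (\<phi> \<star> \<psi>) = dom \<phi> \<odot> dom \<psi>" "cod (\<phi> \<star> \<psi>) = cod \<phi> \<odot> cod \<psi>"
proof -
  have fg: "(\<phi>, \<psi>) \<in> Arr (C1_2 C)"
    using assms by (simp add: Arr_C1_2)
  then show "\<phi> \<star> \<psi> \<in> sq" using functor_c by (simp add: is_functor_def)
  show "sa (\<phi> \<star> \<psi>) = sa \<phi>" "ta (\<phi> \<star> \<psi>) = ta \<psi>"
    using double_category fg by (auto simp: double_category_def)
  show "dom (\<phi> \<star> \<psi>) = dom \<phi> \<odot> dom \<psi>" "cod (\<phi> \<star> \<psi>) = cod \<phi> \<odot> cod \<psi>"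
    using functor_c fg by (simp_all add: is_functor_def C1_2_sel)
qed

text \<open>The two squares share a vertical edge; its domain and codomain are the endpoints
  compared here. This turns composability of squares into composability of horizontal
  morphisms.\<close>

lemma st_dom_cod:
  assumes "\<phi> \<in> sq" "\<psi> \<in> sq" "ta \<phi> = sa \<psi>"
  shows "to (dom \<phi>) = so (dom \<psi>)" "to (cod \<phi>) = so (cod \<psi>)"
  using assms by (metis st_mor)+

text \<open>This is functoriality of \<open>cF C\<close> on a vertical composite in the category
  \<open>C1_2 C\<close> of composable pairs.\<close>

lemma interchange:
  assumes "\<phi> \<in> sq" "\<psi> \<in> sq" "\<phi>' \<in> sq" "\<psi>' \<in> sq"
    and "ta \<phi> = sa \<psi>" "ta \<phi>' = sa \<psi>'" "cod \<phi> = dom \<phi>'" "cod \<psi> = dom \<psi>'"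
  shows "(\<phi>' \<star> \<psi>') \<cdot> (\<phi> \<star> \<psi>) = (\<phi>' \<cdot> \<phi>) \<star> (\<psi>' \<cdot> \<psi>)"
proof -
  have "(\<phi>, \<psi>) \<in> Arr (C1_2 C)" "(\<phi>', \<psi>') \<in> Arr (C1_2 C)"
    using assms by (simp_all add: Arr_C1_2)
  moreover have "Cod (C1_2 C) (\<phi>, \<psi>) = Dom (C1_2 C) (\<phi>', \<psi>')"
    using assms by (simp add: C1_2_sel)
  ultimately have "amap (cF C) (Cmp (C1_2 C) (\<phi>', \<psi>') (\<phi>, \<psi>)) = (\<phi>' \<star> \<psi>') \<cdot> (\<phi> \<star> \<psi>)"
    using functor_c unfolding is_functor_def by blast
  then show ?thesis by (simp add: C1_2_sel)
qed

lemma gg_sq: "\<phi> \<in> gg_squares C \<Longrightarrow> \<phi> \<in> sq"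
  by (induction rule: gg_squares.induct) (simp_all add: globular_def)

lemma ide_gg: "f \<in> hmor \<Longrightarrow> ide f \<in> gg_squares C"
  by (rule gg_squares.glob) (auto simp: globular_def)

lemma wide_subcat_gg: "wide_subcat (C1 C) (gg_squares C)"
  unfolding wide_subcat_def
  by (auto intro: gg_sq gg_squares.vcomp ide_gg)

end

section \<open>Strict associativity and units from identity structure cells\<close>

locale strict_dbl_category = dbl_category C for C :: "('o, 'v, 'h, 's) dblcat" +
  assumes asso_ide: "\<lbrakk>f \<in> hmor; g \<in> hmor; h \<in> hmor; to f = so g; to g = so h\<rbrakk>
      \<Longrightarrow> asso C f g h = ide ((f \<odot> g) \<odot> h)"
    and luni_ide: "f \<in> hmor \<Longrightarrow> luni C f = ide f"
    and runi_ide: "f \<in> hmor \<Longrightarrow> runi C f = ide f"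
begin

lemma nat_iso_asso: "nat_iso (C1_3 C) (C1 C)
       \<lparr>omap = (\<lambda>(f, g, h). (f \<odot> g) \<odot> h), amap = (\<lambda>(\<phi>, \<psi>, \<chi>). (\<phi> \<star> \<psi>) \<star> \<chi>)\<rparr>
       \<lparr>omap = (\<lambda>(f, g, h). f \<odot> g \<odot> h), amap = (\<lambda>(\<phi>, \<psi>, \<chi>). \<phi> \<star> \<psi> \<star> \<chi>)\<rparr>
       (\<lambda>(f, g, h). asso C f g h)"
  and nat_iso_luni: "nat_iso (C1 C) (C1 C)
       \<lparr>omap = (\<lambda>f. io (so f) \<odot> f), amap = (\<lambda>\<phi>. ia (sa \<phi>) \<star> \<phi>)\<rparr> id_ftr (luni C)"
  and nat_iso_runi: "nat_iso (C1 C) (C1 C)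
       \<lparr>omap = (\<lambda>f. f \<odot> io (to f)), amap = (\<lambda>\<phi>. \<phi> \<star> ia (ta \<phi>))\<rparr> id_ftr (runi C)"
  using double_category by (simp_all add: double_category_def)

text \<open>As a component of the associator, \<open>asso C f g h\<close> has codomain
  \<open>f \<odot> g \<odot> h\<close>; as an identity square its codomain is
  \<open>(f \<odot> g) \<odot> h\<close>.\<close>

lemma hcmp_mor_assoc:
  assumes "f \<in> hmor" "g \<in> hmor" "h \<in> hmor" "to f = so g" "to g = so h"
  shows "(f \<odot> g) \<odot> h = f \<odot> g \<odot> h"
proof -
  have "(f, g, h) \<in> Obj (C1_3 C)"
    using assms by (simp add: Obj_C1_3 Obj_C1_2)
  then have "cod (asso C f g h) = f \<odot> g \<odot> h"
    using nat_iso_asso unfolding nat_iso_def by fastforce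
  then show ?thesis using assms by (simp add: asso_ide)
qed

text \<open>In the naturality equation of the associator at \<open>(\<phi>, \<psi>, \<chi>)\<close>
  both components are identity squares and cancel. No globularity is involved.\<close>

lemma hcmp_assoc:
  assumes "\<phi> \<in> sq" "\<psi> \<in> sq" "\<chi> \<in> sq" "ta \<phi> = sa \<psi>" "ta \<psi> = sa \<chi>"
  shows "(\<phi> \<star> \<psi>) \<star> \<chi> = \<phi> \<star> \<psi> \<star> \<chi>"
proof -
  have "(\<phi>, \<psi>, \<chi>) \<in> Arr (C1_3 C)"
    using assms by (simp add: Arr_C1_3 Arr_C1_2)
  then have "asso C (cod \<phi>) (cod \<psi>) (cod \<chi>) \<cdot> ((\<phi> \<star> \<psi>) \<star> \<chi>) =
      (\<phi> \<star> \<psi> \<star> \<chi>) \<cdot> asso C (dom \<phi>) (dom \<psi>) (dom \<chi>)"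
    using nat_iso_asso unfolding nat_iso_def by (fastforce simp: C1_3_sel)
  moreover note st_dom_cod[OF assms(1,2,4)] st_dom_cod[OF assms(2,3,5)]
  moreover have "ide ((cod \<phi> \<odot> cod \<psi>) \<odot> cod \<chi>) \<cdot> ((\<phi> \<star> \<psi>) \<star> \<chi>) = (\<phi> \<star> \<psi>) \<star> \<chi>"
    using vcmp_unit(2)[of "(\<phi> \<star> \<psi>) \<star> \<chi>"] assms by simp
  moreover have "(\<phi> \<star> \<psi> \<star> \<chi>) \<cdot> ide (dom \<phi> \<odot> dom \<psi> \<odot> dom \<chi>) = \<phi> \<star> \<psi> \<star> \<chi>"
    using vcmp_unit(1)[of "\<phi> \<star> \<psi> \<star> \<chi>"] assms by simp
  ultimately show ?thesis
    using assms by (simp add: asso_ide hcmp_mor_assoc)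
qed

lemma hcmp_mor_unit [simp]:
  assumes "f \<in> hmor"
  shows "io (so f) \<odot> f = f" "f \<odot> io (to f) = f"
  using nat_iso_luni nat_iso_runi assms
  unfolding nat_iso_def by (fastforce simp: luni_ide runi_ide)+

text \<open>Naturality of the unitors, whose components are identities; \<open>hcmp_mor_unit\<close>
  makes the boundaries of both sides match.\<close>

lemma hcmp_unit [simp]:
  assumes "\<phi> \<in> sq"
  shows "ia (sa \<phi>) \<star> \<phi> = \<phi>" "\<phi> \<star> ia (ta \<phi>) = \<phi>"
proof -
  have "luni C (cod \<phi>) \<cdot> (ia (sa \<phi>) \<star> \<phi>) = \<phi> \<cdot> luni C (dom \<phi>)"
    "runi C (cod \<phi>) \<cdot> (\<phi> \<star> ia (ta \<phi>)) = \<phi> \<cdot> runi C (dom \<phi>)"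
    using nat_iso_luni nat_iso_runi assms unfolding nat_iso_def id_ftr_def by fastforce+
  then show "ia (sa \<phi>) \<star> \<phi> = \<phi>" "\<phi> \<star> ia (ta \<phi>) = \<phi>"
    using vcmp_unit(2)[of "ia (sa \<phi>) \<star> \<phi>"] vcmp_unit(2)[of "\<phi> \<star> ia (ta \<phi>)"] assms
    by (simp_all add: luni_ide runi_ide)
qed

section \<open>Horizontal and vertical inverses\<close>

lemma hinverse_mor_unique:
  assumes "f \<in> hmor" "g \<in> hmor" "h \<in> hmor"
    and "so g = to f" "to g = so f" "so h = to f" "to h = so f"
    and "g \<odot> f = io (to f)" "f \<odot> h = io (so f)"
  shows "g = h"
proof -
  have "g = g \<odot> f \<odot> h" using assms hcmp_mor_unit(2)[of g] by simp
  also have "\<dots> = (g \<odot> f) \<odot> h" using assms(1-7) by (simp add: hcmp_mor_assoc)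
  also have "\<dots> = h" using assms hcmp_mor_unit(1)[of h] by simp
  finally show ?thesis .
qed

text \<open>Membership of the inverse in \<open>gg_squares C\<close> is part of the relation, here
  and in \<open>vinverse\<close>, so that inverses computed with the operations of \<open>C\<close>
  serve in \<open>gamma C\<close>.\<close>

definition hinverse :: "'s \<Rightarrow> 's \<Rightarrow> bool" where
  "hinverse \<phi> \<psi> \<longleftrightarrow> \<psi> \<in> gg_squares C \<and> sa \<psi> = ta \<phi> \<and> ta \<psi> = sa \<phi> \<and>
     \<phi> \<star> \<psi> = ia (sa \<phi>) \<and> \<psi> \<star> \<phi> = ia (ta \<phi>)"

definition vinverse :: "'s \<Rightarrow> 's \<Rightarrow> bool" where
  "vinverse \<phi> \<psi> \<longleftrightarrow> \<psi> \<in> gg_squares C \<and> dom \<psi> = cod \<phi> \<and> cod \<psi> = dom \<phi> \<and>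
     \<psi> \<cdot> \<phi> = ide (dom \<phi>) \<and> \<phi> \<cdot> \<psi> = ide (cod \<phi>)"

lemma hinverse_ia: "u \<in> Arr (C0 C) \<Longrightarrow> hinverse (ia u) (ia u)"
  using hcmp_unit(1)[of "ia u"] by (simp add: hinverse_def gg_squares.hid)

text \<open>Both \<open>cod \<phi>'\<close> and \<open>dom \<psi>'\<close> are horizontal inverses
  of the one morphism \<open>cod \<phi> = dom \<psi>\<close>, hence equal.\<close>

lemma hinverse_composable:
  assumes "\<phi> \<in> sq" "\<psi> \<in> sq" "hinverse \<phi> \<phi>'" "hinverse \<psi> \<psi>'" "cod \<phi> = dom \<psi>"
  shows "cod \<phi>' = dom \<psi>'"
proof (rule hinverse_mor_unique)
  have [simp]: "\<phi>' \<in> sq" "\<psi>' \<in> sq"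
    using assms by (simp_all add: hinverse_def gg_sq)
  note hinv = assms(3,4)[unfolded hinverse_def]
  show "cod \<phi> \<in> hmor" "cod \<phi>' \<in> hmor" "dom \<psi>' \<in> hmor"
    using assms(1) by simp_all
  show "so (cod \<phi>') = to (cod \<phi>)" "to (cod \<phi>') = so (cod \<phi>)"
    using st_dom_cod[of \<phi> \<phi>'] st_dom_cod[of \<phi>' \<phi>] hinv assms(1) by simp_all
  show "so (dom \<psi>') = to (cod \<phi>)" "to (dom \<psi>') = so (cod \<phi>)"
    using st_dom_cod[of \<psi> \<psi>'] st_dom_cod[of \<psi>' \<psi>] hinv assms(2,5) by simp_all
  \<comment> \<open>Take \<open>cod\<close> of the equation for
    \<open>\<phi>' \<star> \<phi>\<close> and \<open>dom\<close> of the equation for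
    \<open>\<psi> \<star> \<psi>'\<close>.\<close>
  show "cod \<phi>' \<odot> cod \<phi> = io (to (cod \<phi>))" "cod \<phi> \<odot> dom \<psi>' = io (so (cod \<phi>))"
    using hcmp_sq(5)[of \<phi>' \<phi>] hcmp_sq(4)[of \<psi> \<psi>'] hinv assms(1,2,5) by simp_all
qed

text \<open>By interchange the horizontal composite is
  \<open>(\<psi> \<star> \<psi>') \<cdot> (\<phi> \<star> \<phi>')\<close>, a vertical composite of
  squares \<open>ia u\<close>, which functoriality of \<open>ia\<close> merges into one. The order
  of the factors is preserved.\<close>

lemma hinverse_vcmp:
  assumes "\<phi> \<in> sq" "\<psi> \<in> sq" "hinverse \<phi> \<phi>'" "hinverse \<psi> \<psi>'" "cod \<phi> = dom \<psi>"
  shows "hinverse (\<psi> \<cdot> \<phi>) (\<psi>' \<cdot> \<phi>')"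
proof -
  have cd: "cod \<phi>' = dom \<psi>'" using assms by (rule hinverse_composable)
  have sq': "\<phi>' \<in> sq" "\<psi>' \<in> sq"
    using assms by (simp_all add: hinverse_def gg_sq)
  \<comment> \<open>These equalities make the vertical edges composable in \<open>C0 C\<close>, as
    \<open>ia_Cmp\<close> requires.\<close>
  have "so (cod \<phi>) = so (dom \<psi>)" "to (cod \<phi>) = to (dom \<psi>)"
    using assms by simp_all
  then show ?thesis
    using assms cd sq' unfolding hinverse_def
    by (simp add: gg_squares.vcomp interchange[symmetric] ia_Cmp)
qed

text \<open>Here the order reverses: strict associativity brings
  \<open>\<psi> \<star> \<psi>'\<close>, respectively \<open>\<phi>' \<star> \<phi>\<close>,
  together in the middle, where it becomes a unit.\<close>

lemma hinverse_hcmp: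
  assumes "\<phi> \<in> sq" "\<psi> \<in> sq" "hinverse \<phi> \<phi>'" "hinverse \<psi> \<psi>'" "ta \<phi> = sa \<psi>"
  shows "hinverse (\<phi> \<star> \<psi>) (\<psi>' \<star> \<phi>')"
proof -
  have sq': "\<phi>' \<in> sq" "\<psi>' \<in> sq"
    using assms by (simp_all add: hinverse_def gg_sq)
  note hinv = assms(3,4)[unfolded hinverse_def]
  have edges: "sa \<phi>' = ta \<phi>" "ta \<phi>' = sa \<phi>" "sa \<psi>' = ta \<psi>" "ta \<psi>' = sa \<psi>"
    using hinv by simp_all
  have "(\<phi> \<star> \<psi>) \<star> \<psi>' \<star> \<phi>' = \<phi> \<star> (\<psi> \<star> \<psi>') \<star> \<phi>'"
    using assms(1,2,5) sq' edges by (simp add: hcmp_assoc)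
  also have "\<dots> = ia (sa \<phi>)"
    using assms(1,2,5) sq' hinv hcmp_unit(1)[of \<phi>'] by simp
  finally have 1: "(\<phi> \<star> \<psi>) \<star> \<psi>' \<star> \<phi>' = ia (sa \<phi>)" .
  have "(\<psi>' \<star> \<phi>') \<star> \<phi> \<star> \<psi> = \<psi>' \<star> (\<phi>' \<star> \<phi>) \<star> \<psi>"
    using assms(1,2,5) sq' edges by (simp add: hcmp_assoc)
  also have "\<dots> = ia (ta \<psi>)"
    using assms(1,2,5) sq' hinv hcmp_unit(1)[of \<psi>] by simp
  finally have 2: "(\<psi>' \<star> \<phi>') \<star> \<phi> \<star> \<psi> = ia (ta \<psi>)" .
  show ?thesis
    using assms(1,2,5) sq' hinv 1 2 by (simp add: hinverse_def gg_squares.hcomp)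
qed

lemma vinverse_vcmp:
  assumes "\<phi> \<in> sq" "\<psi> \<in> sq" "vinverse \<phi> \<phi>'" "vinverse \<psi> \<psi>'" "cod \<phi> = dom \<psi>"
  shows "vinverse (\<psi> \<cdot> \<phi>) (\<phi>' \<cdot> \<psi>')"
proof -
  have sq': "\<phi>' \<in> sq" "\<psi>' \<in> sq"
    using assms by (simp_all add: vinverse_def gg_sq)
  note vinv = assms(3,4)[unfolded vinverse_def]
  have edges: "dom \<phi>' = cod \<phi>" "cod \<phi>' = dom \<phi>" "dom \<psi>' = cod \<psi>" "cod \<psi>' = dom \<psi>"
    using vinv by simp_all
  have "(\<phi>' \<cdot> \<psi>') \<cdot> \<psi> \<cdot> \<phi> = \<phi>' \<cdot> (\<psi>' \<cdot> \<psi>) \<cdot> \<phi>"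
    using assms(1,2,5) sq' edges by (simp add: vcmp_assoc)
  also have "\<dots> = ide (dom \<phi>)"
    using assms(1,2,5) sq' vinv vcmp_unit(2)[of \<phi>] by simp
  finally have 1: "(\<phi>' \<cdot> \<psi>') \<cdot> \<psi> \<cdot> \<phi> = ide (dom \<phi>)" .
  have "(\<psi> \<cdot> \<phi>) \<cdot> \<phi>' \<cdot> \<psi>' = \<psi> \<cdot> (\<phi> \<cdot> \<phi>') \<cdot> \<psi>'"
    using assms(1,2,5) sq' edges by (simp add: vcmp_assoc)
  also have "\<dots> = ide (cod \<psi>)"
    using assms(1,2,5) sq' vinv vcmp_unit(2)[of \<psi>'] by simp
  finally have 2: "(\<psi> \<cdot> \<phi>) \<cdot> \<phi>' \<cdot> \<psi>' = ide (cod \<psi>)" .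
  show ?thesis
    using assms(1,2,5) sq' vinv 1 2 by (simp add: vinverse_def gg_squares.vcomp)
qed

text \<open>Interchange gives the equations once \<open>\<phi>'\<close> and \<open>\<psi>'\<close>
  are known to share an edge. They do because \<open>ta \<phi>'\<close> and
  \<open>sa \<psi>'\<close> both invert the common edge \<open>ta \<phi> = sa \<psi>\<close> in
  \<open>C0 C\<close>.\<close>

lemma vinverse_hcmp:
  assumes "\<phi> \<in> sq" "\<psi> \<in> sq" "vinverse \<phi> \<phi>'" "vinverse \<psi> \<psi>'" "ta \<phi> = sa \<psi>"
  shows "vinverse (\<phi> \<star> \<psi>) (\<phi>' \<star> \<psi>')"
proof -
  have sq' [simp]: "\<phi>' \<in> sq" "\<psi>' \<in> sq"
    using assms by (simp_all add: vinverse_def gg_sq)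
  note vinv = assms(3,4)[unfolded vinverse_def]
  note bd = st_dom_cod[OF assms(1,2,5)]
  have "Cmp (C0 C) (ta \<phi>') (ta \<phi>) = Ide (C0 C) (to (dom \<phi>))"
    "Cmp (C0 C) (sa \<psi>) (sa \<psi>') = Ide (C0 C) (so (cod \<psi>))"
    using st_vcmp(2)[of \<phi> \<phi>'] st_vcmp(1)[of \<psi>' \<psi>] vinv assms(1,2) by simp_all
  then have "ta \<phi>' = sa \<psi>'"
    using vinv assms(1,2,5) bd
    by (intro inverse_unique[OF cat0, of "ta \<phi>" "ta \<phi>'" "sa \<psi>'"]) simp_all
  then show ?thesis
    using assms(1,2,5) vinv bd by (simp add: vinverse_def gg_squares.hcomp interchange)
qed

end


section \<open>Double categories whose decorated horizontal bicategory is a 2-groupoid\<close>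

text \<open>The 2-groupoid hypothesis, restated without hom categories. The vertical inverse of a
  globular square is required to be globular, so that it can be composed with identity squares on
  either side.\<close>

locale dbl_category_2_groupoid = strict_dbl_category C for C :: "('o, 'v, 'h, 's) dblcat" +
  assumes groupoid0: "groupoid (C0 C)"
    and hmor_inverse: "f \<in> hmor \<Longrightarrow> hinvertible_mor C f"
    and globular_inverse: "globular C \<phi> \<Longrightarrow> \<exists>\<psi>. globular C \<psi> \<and> vinverse \<phi> \<psi>"
begin

text \<open>The vertical inverse is whiskered on both sides by horizontal inverses of the boundary
  morphisms. Interchange then reduces each horizontal composite to a vertical cancellation.\<close>

lemma hinverse_globular:
  assumes glob: "globular C \<phi>"
  shows "\<exists>\<psi>. hinverse \<phi> \<psi>"
proof -
  obtain a b where ab: "a \<in> Obj (C0 C)" "b \<in> Obj (C0 C)"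
    "sa \<phi> = Ide (C0 C) a" "ta \<phi> = Ide (C0 C) b" and \<phi>: "\<phi> \<in> sq"
    using glob unfolding globular_def by blast
  obtain \<phi>' where glob': "globular C \<phi>'" and vinv: "vinverse \<phi> \<phi>'"
    using globular_inverse[OF glob] by blast
  obtain a' b' where ab': "a' \<in> Obj (C0 C)" "b' \<in> Obj (C0 C)"
    "sa \<phi>' = Ide (C0 C) a'" "ta \<phi>' = Ide (C0 C) b'" and \<phi>': "\<phi>' \<in> sq"
    using glob' unfolding globular_def by blast
  define f where "f = dom \<phi>"
  define g where "g = cod \<phi>"
  have fg: "f \<in> hmor" "g \<in> hmor" using \<phi> by (simp_all add: f_def g_def)
  have v: "dom \<phi>' = g" "cod \<phi>' = f" "\<phi>' \<cdot> \<phi> = ide f" "\<phi> \<cdot> \<phi>' = ide g"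
    using vinv by (simp_all add: vinverse_def f_def g_def)
  have ide0: "Dom (C0 C) (Ide (C0 C) x) = x" "Cod (C0 C) (Ide (C0 C) x) = x"
    if "x \<in> Obj (C0 C)" for x
    using cat0 that by (simp_all add: category_def)
  have e: "so f = a" "so g = a" "to f = b" "to g = b"
    using st_mor(7-10)[OF \<phi>] ab ide0 by (simp_all add: f_def g_def)
  \<comment> \<open>The edges of \<open>\<phi>'\<close> are identities that start at the endpoints
    of \<open>dom \<phi>' = g\<close>.\<close>
  have e': "a' = a" "b' = b"
    using st_mor(7,9)[OF \<phi>'] ab' ide0 e v by simp_all
  obtain f' where f': "f' \<in> hmor" "so f' = b" "to f' = a" "f \<odot> f' = io a" "f' \<odot> f = io b"
    using hmor_inverse[OF fg(1)] e unfolding hinvertible_mor_def by auto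
  obtain g' where g': "g' \<in> hmor" "so g' = b" "to g' = a" "g \<odot> g' = io a" "g' \<odot> g = io b"
    using hmor_inverse[OF fg(2)] e unfolding hinvertible_mor_def by auto
  define \<psi> where "\<psi> = ide f' \<star> \<phi>' \<star> ide g'"
  have "\<psi> \<in> gg_squares C"
    unfolding \<psi>_def using glob' f' g' ab' e'
    by (intro gg_squares.hcomp ide_gg) (auto simp: \<phi>' gg_squares.glob)
  \<comment> \<open>This computes \<open>cod \<psi>\<close>, where reassociation is needed. In
    \<open>dom \<psi>\<close>, which is \<open>f' \<odot> g \<odot> g'\<close>, the factor
    \<open>g \<odot> g'\<close> already stands as a subterm.\<close>
  have "f' \<odot> f \<odot> g' = g'"
    using hcmp_mor_assoc[of f' f g'] hcmp_mor_unit(1)[of g'] f' g' fg e by simp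
  then have \<psi>: "\<psi> \<in> sq" "sa \<psi> = Ide (C0 C) b" "ta \<psi> = Ide (C0 C) a" "dom \<psi> = f'" "cod \<psi> = g'"
    using f' g' ab' e' \<phi>' v fg e hcmp_mor_unit(2)[of f']
    by (simp_all add: \<psi>_def)
  have 1: "\<phi> \<star> \<psi> = ia (sa \<phi>)"
  proof -
    \<comment> \<open>Inserting identities at \<open>dom \<phi>\<close> and at
      \<open>cod \<psi>\<close> lets interchange put \<open>\<phi>\<close> and \<open>\<psi>\<close>
      at different heights.\<close>
    have "\<phi> \<star> \<psi> = (\<phi> \<cdot> ide f) \<star> (ide g' \<cdot> \<psi>)"
      using \<phi> \<psi> vcmp_unit(1)[OF \<phi>] vcmp_unit(2)[OF \<psi>(1)] by (simp add: f_def)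
    also have "\<dots> = (\<phi> \<star> ide g') \<cdot> (ide f \<star> \<psi>)"
      using \<phi> \<psi> fg e g' ab by (subst interchange) (simp_all add: f_def)
    \<comment> \<open>Pure reassociation: \<open>hcmp_mor(4)\<close> is withheld because it would
      fuse the two identity squares too early. The next step lets it fuse them into a unit.\<close>
    also have "ide f \<star> \<psi> = (ide f \<star> ide f') \<star> \<phi>' \<star> ide g'"
      unfolding \<psi>_def using fg e f' g' \<phi>' ab' e' by (simp add: hcmp_assoc del: hcmp_mor(4))
    also have "\<dots> = \<phi>' \<star> ide g'"
      using hcmp_unit(1)[of "\<phi>' \<star> ide g'"] fg e f' g' \<phi>' ab' e' by simp
    also have "(\<phi> \<star> ide g') \<cdot> (\<phi>' \<star> ide g') = (\<phi> \<cdot> \<phi>') \<star> (ide g' \<cdot> ide g')"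
      using \<phi> \<phi>' g' ab ab' e' v by (intro interchange) (simp_all add: f_def)
    \<comment> \<open>Since \<open>\<phi> \<cdot> \<phi>' = ide g\<close>, what remains is
      \<open>ide (g \<odot> g') = ide (io a)\<close>, which is \<open>ia\<close> of the identity on
      \<open>a\<close>.\<close>
    also have "\<dots> = ia (sa \<phi>)"
      using v vcmp_unit(1)[of "ide g'"] g' fg e ab by simp
    finally show ?thesis .
  qed
  have 2: "\<psi> \<star> \<phi> = ia (ta \<phi>)"
  proof -
    \<comment> \<open>The mirror computation: now \<open>g' \<odot> g\<close> is the unit that
      disappears, and \<open>\<phi>' \<cdot> \<phi> = ide f\<close> cancels against
      \<open>f'\<close>.\<close>
    have "\<psi> \<star> \<phi> = (\<psi> \<cdot> ide f') \<star> (ide g \<cdot> \<phi>)"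
      using \<phi> \<psi> vcmp_unit(2)[OF \<phi>] vcmp_unit(1)[OF \<psi>(1)] by (simp add: g_def)
    also have "\<dots> = (\<psi> \<star> ide g) \<cdot> (ide f' \<star> \<phi>)"
      using \<phi> \<psi> fg e f' ab by (subst interchange) (simp_all add: g_def)
    also have "\<psi> \<star> ide g = (ide f' \<star> \<phi>') \<star> ide g' \<star> ide g"
      unfolding \<psi>_def using fg e f' g' \<phi>' ab' e' by (simp add: hcmp_assoc del: hcmp_mor(4))
    also have "\<dots> = ide f' \<star> \<phi>'"
      using hcmp_unit(2)[of "ide f' \<star> \<phi>'"] fg e f' g' \<phi>' ab' e' by simp
    also have "(ide f' \<star> \<phi>') \<cdot> (ide f' \<star> \<phi>) = (ide f' \<cdot> ide f') \<star> (\<phi>' \<cdot> \<phi>)"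
      using \<phi> \<phi>' f' ab ab' e' v by (intro interchange) (simp_all add: g_def)
    also have "\<dots> = ia (ta \<phi>)"
      using v vcmp_unit(1)[of "ide f'"] f' fg e ab by simp
    finally show ?thesis .
  qed
  show ?thesis
    using \<open>\<psi> \<in> gg_squares C\<close> \<psi> ab 1 2 unfolding hinverse_def by auto
qed

lemma gg_hinverse: "\<phi> \<in> gg_squares C \<Longrightarrow> \<exists>\<psi>. hinverse \<phi> \<psi>"
proof (induction rule: gg_squares.induct)
  case (vcomp \<phi> \<psi>)
  then show ?case by (meson gg_sq hinverse_vcmp)
next
  case (hcomp \<phi> \<psi>)
  then show ?case by (meson gg_sq hinverse_hcmp)
qed (use hinverse_globular hinverse_ia in blast)+

text \<open>In the case \<open>hid\<close> the groupoid structure of the decoration enters: the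
  functor \<open>iF C\<close> carries an inverse of \<open>u\<close> to a vertical inverse of
  \<open>ia u\<close>.\<close>

lemma gg_vinverse: "\<phi> \<in> gg_squares C \<Longrightarrow> \<exists>\<psi>. vinverse \<phi> \<psi>"
proof (induction rule: gg_squares.induct)
  case (hid u)
  then obtain v where "v \<in> Arr (C0 C)" "Dom (C0 C) v = Cod (C0 C) u" "Cod (C0 C) v = Dom (C0 C) u"
    "Cmp (C0 C) v u = Ide (C0 C) (Dom (C0 C) u)" "Cmp (C0 C) u v = Ide (C0 C) (Cod (C0 C) u)"
    using groupoid0 unfolding groupoid_def invertible_def by blast
  moreover have "Dom (C0 C) u \<in> Obj (C0 C)" "Cod (C0 C) u \<in> Obj (C0 C)"
    using cat0 hid by (simp_all add: category_def)
  ultimately have "vinverse (ia u) (ia v)"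
    using hid by (simp add: vinverse_def gg_squares.hid ia_Cmp[symmetric])
  then show ?case ..
next
  case (vcomp \<phi> \<psi>)
  then show ?case by (meson gg_sq vinverse_vcmp)
next
  case (hcomp \<phi> \<psi>)
  then show ?case by (meson gg_sq vinverse_hcmp)
qed (use globular_inverse in blast)

section \<open>The double category structure of \<open>gamma C\<close>\<close>

lemma gamma_sel [simp]:
  "C0 (gamma C) = C0 C" "C1 (gamma C) = (C1 C)\<lparr>Arr := gg_squares C\<rparr>"
  "sF (gamma C) = sF C" "tF (gamma C) = tF C" "iF (gamma C) = iF C" "cF (gamma C) = cF C"
  "asso (gamma C) = asso C" "luni (gamma C) = luni C" "runi (gamma C) = runi C"
  by (simp_all add: gamma_def)

lemma invertible_gamma: "\<phi> \<in> gg_squares C \<Longrightarrow> invertible ((C1 C)\<lparr>Arr := gg_squares C\<rparr>) \<phi>"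
  using gg_vinverse[of \<phi>] unfolding invertible_def vinverse_def by auto

lemma globular_gamma: "globular (gamma C) \<phi> \<longleftrightarrow> globular C \<phi>"
  using gg_sq[of \<phi>] gg_squares.glob[of C \<phi>] by (auto simp: globular_def)

text \<open>Brings the composable pairs of \<open>gamma C\<close> into the form of a wide
  subcategory of \<open>C1_2 C\<close>, so that \<open>cF C\<close> can be restricted to it.\<close>

lemma C1_2_gamma: "C1_2 (gamma C) = (C1_2 C)\<lparr>Arr := Arr (C1_2 C) \<inter> gg_squares C \<times> gg_squares C\<rparr>"
  by (rule cat.equality) (auto simp: Obj_C1_2 Arr_C1_2 C1_2_sel intro: gg_sq)

lemma C1_3_gamma: "C1_3 (gamma C) =
    (C1_3 C)\<lparr>Arr := Arr (C1_3 C) \<inter> gg_squares C \<times> gg_squares C \<times> gg_squares C\<rparr>"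
  by (rule cat.equality)
    (auto simp: Obj_C1_3 Arr_C1_3 C1_3_sel Obj_C1_2 Arr_C1_2 intro: gg_sq)

lemma wide_subcat_C1_2:
  "wide_subcat (C1_2 C) (Arr (C1_2 C) \<inter> gg_squares C \<times> gg_squares C)"
  using wide_subcat_gg
  unfolding wide_subcat_def by (auto simp: Obj_C1_2 Arr_C1_2 C1_2_sel)

lemma wide_subcat_C1_3:
  "wide_subcat (C1_3 C) (Arr (C1_3 C) \<inter> gg_squares C \<times> gg_squares C \<times> gg_squares C)"
  using wide_subcat_gg
  unfolding wide_subcat_def
  by (auto simp: Obj_C1_2 Arr_C1_2 C1_2_sel Obj_C1_3 Arr_C1_3 C1_3_sel)

lemma double_category_gamma: "double_category (gamma C)"
proof -
  let ?G = "(C1 C)\<lparr>Arr := gg_squares C\<rparr>"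
  note w0 = wide_subcat_Arr[OF cat0] and w1 = wide_subcat_gg
  have "category ?G" using category_wide_subcat[OF cat1 w1] .
  moreover have "is_functor ?G (C0 C) (sF C)" "is_functor ?G (C0 C) (tF C)"
    using is_functor_wide_subcat[OF functor_s w1 w0] is_functor_wide_subcat[OF functor_t w1 w0]
    by (simp_all add: cat_update_Arr_Arr gg_sq)
  moreover have "is_functor (C0 C) ?G (iF C)"
    using is_functor_wide_subcat[OF functor_i w0 w1]
    by (simp add: cat_update_Arr_Arr gg_squares.hid)
  moreover have "is_functor (C1_2 (gamma C)) ?G (cF C)"
    unfolding C1_2_gamma
    by (rule is_functor_wide_subcat[OF functor_c wide_subcat_C1_2 w1])
      (auto simp: Arr_C1_2 intro: gg_squares.hcomp)
  moreover have "nat_iso (C1_3 (gamma C)) ?G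
       \<lparr>omap = (\<lambda>(f, g, h). (f \<odot> g) \<odot> h), amap = (\<lambda>(\<phi>, \<psi>, \<chi>). (\<phi> \<star> \<psi>) \<star> \<chi>)\<rparr>
       \<lparr>omap = (\<lambda>(f, g, h). f \<odot> g \<odot> h), amap = (\<lambda>(\<phi>, \<psi>, \<chi>). \<phi> \<star> \<psi> \<star> \<chi>)\<rparr>
       (\<lambda>(f, g, h). asso C f g h)"
    unfolding C1_3_gamma
    by (rule nat_iso_wide_subcat[OF nat_iso_asso wide_subcat_C1_3 w1])
      \<comment> \<open>By \<open>asso_ide\<close> the components are identity squares, which are
        globularly generated and hence invertible inside \<open>gamma C\<close>.\<close>
      (auto simp: Arr_C1_3 Arr_C1_2 Obj_C1_3 Obj_C1_2 gg_sq asso_ide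
        intro!: gg_squares.hcomp invertible_gamma ide_gg)
  moreover have "nat_iso ?G ?G
       \<lparr>omap = (\<lambda>f. io (so f) \<odot> f), amap = (\<lambda>\<phi>. ia (sa \<phi>) \<star> \<phi>)\<rparr> id_ftr (luni C)"
    by (rule nat_iso_wide_subcat[OF nat_iso_luni w1 w1])
      (auto simp: gg_sq id_ftr_def luni_ide
        intro!: invertible_gamma ide_gg)
  moreover have "nat_iso ?G ?G
       \<lparr>omap = (\<lambda>f. f \<odot> io (to f)), amap = (\<lambda>\<phi>. \<phi> \<star> ia (ta \<phi>))\<rparr> id_ftr (runi C)"
    by (rule nat_iso_wide_subcat[OF nat_iso_runi w1 w1])
      (auto simp: gg_sq id_ftr_def runi_ide
        intro!: invertible_gamma ide_gg)
  moreover have "Obj (C1_2 (gamma C)) = Obj (C1_2 C)" "Obj (C1_3 (gamma C)) = Obj (C1_3 C)"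
    by (simp_all add: C1_2_gamma C1_3_gamma)
  moreover have "\<forall>(\<phi>, \<psi>)\<in>Arr (C1_2 (gamma C)). sa (\<phi> \<star> \<psi>) = sa \<phi> \<and> ta (\<phi> \<star> \<psi>) = ta \<psi>"
    by (auto simp: C1_2_gamma Arr_C1_2)
  \<comment> \<open>The remaining clauses, among them pentagon and triangle, speak of vertical data,
    composable horizontal morphisms and globular structure cells. All of these are the same for
    \<open>C\<close>.\<close>
  ultimately show ?thesis
    using double_category unfolding double_category_def
    by (simp add: globular_gamma)
qed

lemma double_groupoid_gamma: "double_groupoid (gamma C)"
proof -
  have "hinvertible_mor (gamma C) f" if "f \<in> hmor" for f
    using hmor_inverse[OF that] by (simp add: hinvertible_mor_def)
  moreover have "hinvertible_sq (gamma C) \<phi>" if "\<phi> \<in> gg_squares C" for \<phi>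
    using gg_hinverse[OF that] that by (auto simp: hinvertible_sq_def hinverse_def)
  ultimately show ?thesis
    using double_category_gamma groupoid0 invertible_gamma
    by (simp add: double_groupoid_def groupoid_def)
qed

end

section \<open>Reading the hypothesis on the decorated horizontal bicategory inside
  \<open>C\<close>\<close>

lemma dbl_category_2_groupoid_Hstar:
  assumes dc: "double_category C" and dg: "decorated_2_groupoid (Hstar C)"
  shows "dbl_category_2_groupoid C"
proof -
  interpret dbl_category C by unfold_locales (rule dc)
  have tg: "two_groupoid (hbicat C)" and gr: "groupoid (C0 C)"
    using dg by (simp_all add: decorated_2_groupoid_def Hstar_def)
  then have st: "strict_2_category (hbicat C)" by (simp add: two_groupoid_def)
  interpret strict_dbl_category C
  proof
    fix f g h assume fgh: "f \<in> hmor" "g \<in> hmor" "h \<in> hmor" "to f = so g" "to g = so h"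
    \<comment> \<open>The clauses for \<open>hbicat C\<close> are indexed by 0-cells, so each
      morphism is placed in the hom category of its own endpoints. As \<open>hhom\<close> changes
      only the carriers, identities there are those of \<open>C1 C\<close>.\<close>
    then have "f \<in> Obj (hhom C (so f) (so g))" "g \<in> Obj (hhom C (so g) (so h))"
      "h \<in> Obj (hhom C (so h) (to h))"
      by (simp_all add: hhom_def)
    moreover have "\<forall>a\<in>Obj (C0 C). \<forall>b\<in>Obj (C0 C). \<forall>c\<in>Obj (C0 C). \<forall>d\<in>Obj (C0 C).
        \<forall>f\<in>Obj (hhom C a b). \<forall>g\<in>Obj (hhom C b c). \<forall>h\<in>Obj (hhom C c d).
          asso C f g h = Ide (hhom C a d) ((f \<odot> g) \<odot> h)"
      using st by (simp add: strict_2_category_def hbicat_def)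
    ultimately have "asso C f g h = Ide (hhom C (so f) (to h)) ((f \<odot> g) \<odot> h)"
      using fgh st_mor(1,2) by blast
    then show "asso C f g h = ide ((f \<odot> g) \<odot> h)" by (simp add: hhom_def)
  next
    fix f assume f: "f \<in> hmor"
    then have "f \<in> Obj (hhom C (so f) (to f))"
      by (simp add: hhom_def)
    moreover have "\<forall>a\<in>Obj (C0 C). \<forall>b\<in>Obj (C0 C). \<forall>f\<in>Obj (hhom C a b).
        luni C f = Ide (hhom C a b) f \<and> runi C f = Ide (hhom C a b) f"
      using st by (simp add: strict_2_category_def hbicat_def)
    ultimately have "luni C f = Ide (hhom C (so f) (to f)) f \<and>
        runi C f = Ide (hhom C (so f) (to f)) f"
      using f st_mor(1,2) by blast
    then show "luni C f = ide f" "runi C f = ide f" by (simp_all add: hhom_def)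
  qed
  show ?thesis
  proof
    show "groupoid (C0 C)" by (rule gr)
  next
    fix f assume f: "f \<in> hmor"
    then have "f \<in> Obj (hhom C (so f) (to f))"
      by (simp add: hhom_def)
    moreover have "\<forall>a\<in>Obj (C0 C). \<forall>b\<in>Obj (C0 C). \<forall>f\<in>Obj (hhom C a b).
        \<exists>g\<in>Obj (hhom C b a). f \<odot> g = io a \<and> g \<odot> f = io b"
      using tg by (simp add: two_groupoid_def hbicat_def)
    ultimately obtain g where "g \<in> Obj (hhom C (to f) (so f))"
      "f \<odot> g = io (so f)" "g \<odot> f = io (to f)"
      using f st_mor(1,2) by meson
    then show "hinvertible_mor C f"
      using f by (auto simp: hinvertible_mor_def hhom_def)
  next
    fix \<phi> assume "globular C \<phi>"
    then obtain a b where ab: "a \<in> Obj (C0 C)" "b \<in> Obj (C0 C)"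
      and "\<phi> \<in> Arr (hhom C a b)"
      unfolding globular_def hhom_def by auto
    then have "invertible (hhom C a b) \<phi>"
      using tg by (simp add: two_groupoid_def hbicat_def)
    then obtain \<psi> where "\<psi> \<in> Arr (hhom C a b)" "dom \<psi> = cod \<phi>" "cod \<psi> = dom \<phi>"
      "\<psi> \<cdot> \<phi> = ide (dom \<phi>)" "\<phi> \<cdot> \<psi> = ide (cod \<phi>)"
      by (auto simp: invertible_def hhom_def)
    \<comment> \<open>An inverse in \<open>hhom C a b\<close> has identity edges by definition of
      that category, so it is globular and thus in \<open>gg_squares C\<close>.\<close>
    moreover from this ab have "globular C \<psi>"
      by (auto simp: globular_def hhom_def)
    ultimately show "\<exists>\<psi>. globular C \<psi> \<and> vinverse \<phi> \<psi>"
      by (auto simp: vinverse_def intro: gg_squares.glob)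
  qed
qed

theorem corollary3p4:
  fixes C :: "('o, 'v, 'h, 's) dblcat"
  assumes "double_category C"
    and "decorated_2_groupoid (Hstar C)"
  shows "double_groupoid (gamma C)"
  using dbl_category_2_groupoid.double_groupoid_gamma[OF dbl_category_2_groupoid_Hstar[OF assms]] .

end
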